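(* Let $(g,d,f,\xi)$ be an optimal solution of the SC-ST clearing problem and let $(\pi,\overline{\lambda})$ be an optimal solution of its dual problem. Then revenue adequacy holds: $$\sum_{j\in\mathcal{D}^{+}}\pi_jd_j-\sum_{i\in\mathcal{G}^{-}}\pi_ig_i=-\sum_{j\in\mathcal{D}^{-}}\pi_jd_j+\sum_{i\in\mathcal{G}^{+}}\pi_ig_i+\sum_{l\in\mathcal{L}}\pi_lf_l+\sum_{m\in\mathcal{M}}\pi_m\xi_m.$$
   Context: Setting (space-time supply chain, SC-ST). $\mathcal{N}$ is a finite set of spatial nodes, $\mathcal{T}$ a finite ordered set of times, $\mathcal{S}=\mathcal{N}\times\mathcal{T}$ the set of space-time nodes $s=(n,t)$, $\mathcal{P}$ a finite set of products. There are finite sets of stakeholders (players): suppliers $\mathcal{G}$, consumers $\mathcal{D}$, transport providers $\mathcal{L}$, technology providers $\mathcal{M}$. - Supplier $i$: node $s(i)\in\mathcal{S}$, product $p(i)\in\mathcal{P}$, flow $g_i\ge0$, capacity $\overline{g}_i\ge0$, bid $\alpha^g_i\in\mathbb{R}$. - Consumer $j$: node $s(j)\in\mathcal{S}$, product $p(j)\in\mathcal{P}$, flow $d_j\ge0$, capacity $\overline{d}_j\ge0$, bid $\alpha^d_j\in\mathbb{R}$. - Transport provider $l$: base node $s_b(l)\in\mathcal{S}$, receiving node $s_r(l)\in\mathcal{S}$, product $p(l)\in\mathcal{P}$, flow $f_l\ge0$, capacity $\overline{f}_l\ge0$, bid $\alpha^f_l\ge0$. - Technology provider $m$: node $s(m)\in\mathcal{S}$,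 sets $\mathcal{P}^{con}_m,\mathcal{P}^{gen}_m\subset\mathcal{P}$ of consumed and generated products, yields $\gamma_{m,p}\ge0$ with $\gamma_{m,\bar p_m}=1$ for a reference product $\bar p_m\in\mathcal{P}^{con}_m$, flow $\xi_m\ge0$, capacity $\overline{\xi}_m\ge0$, bid $\alpha^\xi_m\ge0$. Bid-sign subsets: $\mathcal{G}^+=\{i\in\mathcal{G}:\alpha^g_i\ge0\}$, $\mathcal{G}^-=\{i\in\mathcal{G}:\alpha^g_i<0\}$, $\mathcal{D}^+=\{j\in\mathcal{D}:\alpha^d_j\ge0\}$, $\mathcal{D}^-=\{j\in\mathcal{D}:\alpha^d_j<0\}$. For $(s,p)\in\mathcal{S}\times\mathcal{P}$: $\mathcal{G}_{s,p}=\{i:s(i)=s,p(i)=p\}$, $\mathcal{D}_{s,p}=\{j:s(j)=s,p(j)=p\}$, $\mathcal{L}^{in}_{s,p}=\{l:s_r(l)=s,p(l)=p\}$, $\mathcal{L}^{out}_{s,p}=\{l:s_b(l)=s,p(l)=p\}$, $\mathcal{M}^{con}_{s,p}=\{m:s(m)=s,p\in\mathcal{P}^{con}_m\}$, $\mathcal{M}^{gen}_{s,p}=\{m:s(m)=s,p\in\mathcal{P}^{gen}_m\}$. SC-ST clearing problem (primal): maximize $\sum_j\alpha^d_jd_j-\sum_i\alpha^g_ig_i-\sum_l\alpha^f_lf_l-\sum_m\alpha^\xi_m\xi_m$ over nonnegative $(g,d,f,\xi)$ subject to the clearing constraints, for all $(s,p)\in\mathcal{S}\times\mathcal{P}$ (dual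 variable $\pi_{s,p}\in\mathbb{R}$, the clearing price), $$\sum_{i\in\mathcal{G}_{s,p}}g_i+\sum_{l\in\mathcal{L}^{in}_{s,p}}f_l+\sum_{m\in\mathcal{M}^{gen}_{s,p}}\gamma_{m,p}\xi_m=\sum_{j\in\mathcal{D}_{s,p}}d_j+\sum_{l\in\mathcal{L}^{out}_{s,p}}f_l+\sum_{m\in\mathcal{M}^{con}_{s,p}}\gamma_{m,p}\xi_m,$$ and capacity constraints $g_i\le\overline{g}_i$, $d_j\le\overline{d}_j$, $f_l\le\overline{f}_l$, $\xi_m\le\overline{\xi}_m$ (dual variables $\overline{\lambda}_i,\overline{\lambda}_j,\overline{\lambda}_l,\overline{\lambda}_m\ge0$). Stakeholder prices: $\pi_i=\pi_{s(i),p(i)}$, $\pi_j=\pi_{s(j),p(j)}$, $\pi_l=\pi_{s_r(l),p(l)}-\pi_{s_b(l),p(l)}$, $\pi_m=\sum_{p\in\mathcal{P}^{gen}_m}\gamma_{m,p}\pi_{s(m),p}-\sum_{p\in\mathcal{P}^{con}_m}\gamma_{m,p}\pi_{s(m),p}$. Dual problem: minimize $\sum_i\overline{g}_i\overline{\lambda}_i+\sum_j\overline{d}_j\overline{\lambda}_j+\sum_l\overline{f}_l\overline{\lambda}_l+\sum_m\overline{\xi}_m\overline{\lambda}_m$ over $\pi$ (free) and $\overline{\lambda}\ge0$ subject to $\pi_i-\overline{\lambda}_i\le\alpha^g_i$, $\pi_j+\overline{\lambda}_j\ge\alpha^d_j$, $\pi_l-\overline{\lambda}_l\le\alpha^f_l$,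 $\pi_m-\overline{\lambda}_m\le\alpha^\xi_m$ for all players. *)

theory Defs
  imports Complex_Main
begin

text \<open>
  The data of a space-time supply chain. A space-time node is a pair in
  \<open>nodes E \<times> periods E\<close>; the finite index sets are carriers inside arbitrary types, and the
  remaining fields are only meaningful on these carriers.
\<close>

record ('n, 't, 'p, 'i, 'j, 'l, 'm) supply_chain =
  nodes :: "'n set"
  periods :: "'t set"
  products :: "'p set"
  suppliers :: "'i set"
  consumers :: "'j set"
  transporters :: "'l set"
  technologies :: "'m set"
  sup_node :: "'i \<Rightarrow> 'n \<times> 't"
  sup_prod :: "'i \<Rightarrow> 'p"
  sup_cap :: "'i \<Rightarrow> real"
  sup_bid :: "'i \<Rightarrow> real"
  con_node :: "'j \<Rightarrow> 'n \<times> 't"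
  con_prod :: "'j \<Rightarrow> 'p"
  con_cap :: "'j \<Rightarrow> real"
  con_bid :: "'j \<Rightarrow> real"
  tra_base :: "'l \<Rightarrow> 'n \<times> 't"
  tra_recv :: "'l \<Rightarrow> 'n \<times> 't"
  tra_prod :: "'l \<Rightarrow> 'p"
  tra_cap :: "'l \<Rightarrow> real"
  tra_bid :: "'l \<Rightarrow> real"
  tec_node :: "'m \<Rightarrow> 'n \<times> 't"
  tec_con :: "'m \<Rightarrow> 'p set"
  tec_gen :: "'m \<Rightarrow> 'p set"
  tec_ref :: "'m \<Rightarrow> 'p"
  tec_yield :: "'m \<Rightarrow> 'p \<Rightarrow> real"
  tec_cap :: "'m \<Rightarrow> real"
  tec_bid :: "'m \<Rightarrow> real"

definition st_nodes :: "('n, 't, 'p, 'i, 'j, 'l, 'm) supply_chain \<Rightarrow> ('n \<times> 't) set" where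
  "st_nodes E = nodes E \<times> periods E"

definition sc_st :: "('n, 't::linorder, 'p, 'i, 'j, 'l, 'm) supply_chain \<Rightarrow> bool" where
  "sc_st E \<longleftrightarrow>
     finite (nodes E) \<and> finite (periods E) \<and> finite (products E) \<and>
     finite (suppliers E) \<and> finite (consumers E) \<and>
     finite (transporters E) \<and> finite (technologies E) \<and>
     (\<forall>i\<in>suppliers E. sup_node E i \<in> st_nodes E \<and> sup_prod E i \<in> products E \<and>
        0 \<le> sup_cap E i) \<and>
     (\<forall>j\<in>consumers E. con_node E j \<in> st_nodes E \<and> con_prod E j \<in> products E \<and>
        0 \<le> con_cap E j) \<and>
     (\<forall>l\<in>transporters E. tra_base E l \<in> st_nodes E \<and> tra_recv E l \<in> st_nodes E \<and>
        tra_prod E l \<in> products E \<and> 0 \<le> tra_cap E l \<and> 0 \<le> tra_bid E l) \<and>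
     (\<forall>m\<in>technologies E. tec_node E m \<in> st_nodes E \<and>
        tec_con E m \<subseteq> products E \<and> tec_gen E m \<subseteq> products E \<and>
        tec_ref E m \<in> tec_con E m \<and> tec_yield E m (tec_ref E m) = 1 \<and>
        (\<forall>p\<in>products E. 0 \<le> tec_yield E m p) \<and>
        0 \<le> tec_cap E m \<and> 0 \<le> tec_bid E m)"

definition suppliers_pos :: "('n, 't, 'p, 'i, 'j, 'l, 'm) supply_chain \<Rightarrow> 'i set" where
  "suppliers_pos E = {i \<in> suppliers E. sup_bid E i \<ge> 0}"

definition suppliers_neg :: "('n, 't, 'p, 'i, 'j, 'l, 'm) supply_chain \<Rightarrow> 'i set" where
  "suppliers_neg E = {i \<in> suppliers E. sup_bid E i < 0}"

definition consumers_pos :: "('n, 't, 'p, 'i, 'j, 'l, 'm) supply_chain \<Rightarrow> 'j set" where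
  "consumers_pos E = {j \<in> consumers E. con_bid E j \<ge> 0}"

definition consumers_neg :: "('n, 't, 'p, 'i, 'j, 'l, 'm) supply_chain \<Rightarrow> 'j set" where
  "consumers_neg E = {j \<in> consumers E. con_bid E j < 0}"

definition sup_at ::
  "('n, 't, 'p, 'i, 'j, 'l, 'm) supply_chain \<Rightarrow> 'n \<times> 't \<Rightarrow> 'p \<Rightarrow> 'i set" where
  "sup_at E s p = {i \<in> suppliers E. sup_node E i = s \<and> sup_prod E i = p}"

definition con_at ::
  "('n, 't, 'p, 'i, 'j, 'l, 'm) supply_chain \<Rightarrow> 'n \<times> 't \<Rightarrow> 'p \<Rightarrow> 'j set" where
  "con_at E s p = {j \<in> consumers E. con_node E j = s \<and> con_prod E j = p}"

definition tra_in ::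
  "('n, 't, 'p, 'i, 'j, 'l, 'm) supply_chain \<Rightarrow> 'n \<times> 't \<Rightarrow> 'p \<Rightarrow> 'l set" where
  "tra_in E s p = {l \<in> transporters E. tra_recv E l = s \<and> tra_prod E l = p}"

definition tra_out ::
  "('n, 't, 'p, 'i, 'j, 'l, 'm) supply_chain \<Rightarrow> 'n \<times> 't \<Rightarrow> 'p \<Rightarrow> 'l set" where
  "tra_out E s p = {l \<in> transporters E. tra_base E l = s \<and> tra_prod E l = p}"

definition tec_con_at ::
  "('n, 't, 'p, 'i, 'j, 'l, 'm) supply_chain \<Rightarrow> 'n \<times> 't \<Rightarrow> 'p \<Rightarrow> 'm set" where
  "tec_con_at E s p = {m \<in> technologies E. tec_node E m = s \<and> p \<in> tec_con E m}"

definition tec_gen_at ::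
  "('n, 't, 'p, 'i, 'j, 'l, 'm) supply_chain \<Rightarrow> 'n \<times> 't \<Rightarrow> 'p \<Rightarrow> 'm set" where
  "tec_gen_at E s p = {m \<in> technologies E. tec_node E m = s \<and> p \<in> tec_gen E m}"

text \<open>Primal variables are tuples \<open>(g, d, f, \<xi>)\<close>.\<close>

type_synonym ('i, 'j, 'l, 'm) flows =
  "('i \<Rightarrow> real) \<times> ('j \<Rightarrow> real) \<times> ('l \<Rightarrow> real) \<times> ('m \<Rightarrow> real)"

fun primal_objective ::
  "('n, 't, 'p, 'i, 'j, 'l, 'm) supply_chain \<Rightarrow> ('i, 'j, 'l, 'm) flows \<Rightarrow> real" where
  "primal_objective E (g, d, f, \<xi>) =
     (\<Sum>j\<in>consumers E. con_bid E j * d j) - (\<Sum>i\<in>suppliers E. sup_bid E i * g i)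
     - (\<Sum>l\<in>transporters E. tra_bid E l * f l) - (\<Sum>m\<in>technologies E. tec_bid E m * \<xi> m)"

fun primal_feasible ::
  "('n, 't, 'p, 'i, 'j, 'l, 'm) supply_chain \<Rightarrow> ('i, 'j, 'l, 'm) flows \<Rightarrow> bool" where
  "primal_feasible E (g, d, f, \<xi>) \<longleftrightarrow>
     (\<forall>i\<in>suppliers E. 0 \<le> g i \<and> g i \<le> sup_cap E i) \<and>
     (\<forall>j\<in>consumers E. 0 \<le> d j \<and> d j \<le> con_cap E j) \<and>
     (\<forall>l\<in>transporters E. 0 \<le> f l \<and> f l \<le> tra_cap E l) \<and>
     (\<forall>m\<in>technologies E. 0 \<le> \<xi> m \<and> \<xi> m \<le> tec_cap E m) \<and>
     (\<forall>s\<in>st_nodes E. \<forall>p\<in>products E.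
        (\<Sum>i\<in>sup_at E s p. g i) + (\<Sum>l\<in>tra_in E s p. f l)
          + (\<Sum>m\<in>tec_gen_at E s p. tec_yield E m p * \<xi> m)
        = (\<Sum>j\<in>con_at E s p. d j) + (\<Sum>l\<in>tra_out E s p. f l)
          + (\<Sum>m\<in>tec_con_at E s p. tec_yield E m p * \<xi> m))"

definition primal_optimal ::
  "('n, 't, 'p, 'i, 'j, 'l, 'm) supply_chain \<Rightarrow> ('i, 'j, 'l, 'm) flows \<Rightarrow> bool" where
  "primal_optimal E x \<longleftrightarrow> is_arg_max (primal_objective E) (primal_feasible E) x"

type_synonym ('n, 't, 'p) prices = "'n \<times> 't \<Rightarrow> 'p \<Rightarrow> real"

definition sup_price ::
  "('n, 't, 'p, 'i, 'j, 'l, 'm) supply_chain \<Rightarrow> ('n, 't, 'p) prices \<Rightarrow> 'i \<Rightarrow> real" where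
  "sup_price E \<pi> i = \<pi> (sup_node E i) (sup_prod E i)"

definition con_price ::
  "('n, 't, 'p, 'i, 'j, 'l, 'm) supply_chain \<Rightarrow> ('n, 't, 'p) prices \<Rightarrow> 'j \<Rightarrow> real" where
  "con_price E \<pi> j = \<pi> (con_node E j) (con_prod E j)"

definition tra_price ::
  "('n, 't, 'p, 'i, 'j, 'l, 'm) supply_chain \<Rightarrow> ('n, 't, 'p) prices \<Rightarrow> 'l \<Rightarrow> real" where
  "tra_price E \<pi> l = \<pi> (tra_recv E l) (tra_prod E l) - \<pi> (tra_base E l) (tra_prod E l)"

definition tec_price ::
  "('n, 't, 'p, 'i, 'j, 'l, 'm) supply_chain \<Rightarrow> ('n, 't, 'p) prices \<Rightarrow> 'm \<Rightarrow> real" where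
  "tec_price E \<pi> m =
     (\<Sum>p\<in>tec_gen E m. tec_yield E m p * \<pi> (tec_node E m) p)
     - (\<Sum>p\<in>tec_con E m. tec_yield E m p * \<pi> (tec_node E m) p)"

text \<open>
  Dual variables are pairs \<open>(\<pi>, lam)\<close>, where \<open>lam\<close> has one component for each of the
  four classes of stakeholders.
\<close>

type_synonym ('n, 't, 'p, 'i, 'j, 'l, 'm) duals =
  "('n, 't, 'p) prices \<times> ('i, 'j, 'l, 'm) flows"

fun dual_objective ::
  "('n, 't, 'p, 'i, 'j, 'l, 'm) supply_chain \<Rightarrow>
   ('n, 't, 'p, 'i, 'j, 'l, 'm) duals \<Rightarrow> real" where
  "dual_objective E (\<pi>, lam_g, lam_d, lam_f, lam_\<xi>) =
     (\<Sum>i\<in>suppliers E. sup_cap E i * lam_g i) + (\<Sum>j\<in>consumers E. con_cap E j * lam_d j)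
     + (\<Sum>l\<in>transporters E. tra_cap E l * lam_f l) + (\<Sum>m\<in>technologies E. tec_cap E m * lam_\<xi> m)"

fun dual_feasible ::
  "('n, 't, 'p, 'i, 'j, 'l, 'm) supply_chain \<Rightarrow>
   ('n, 't, 'p, 'i, 'j, 'l, 'm) duals \<Rightarrow> bool" where
  "dual_feasible E (\<pi>, lam_g, lam_d, lam_f, lam_\<xi>) \<longleftrightarrow>
     (\<forall>i\<in>suppliers E. 0 \<le> lam_g i \<and> sup_price E \<pi> i - lam_g i \<le> sup_bid E i) \<and>
     (\<forall>j\<in>consumers E. 0 \<le> lam_d j \<and> con_price E \<pi> j + lam_d j \<ge> con_bid E j) \<and>
     (\<forall>l\<in>transporters E. 0 \<le> lam_f l \<and> tra_price E \<pi> l - lam_f l \<le> tra_bid E l) \<and>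
     (\<forall>m\<in>technologies E. 0 \<le> lam_\<xi> m \<and> tec_price E \<pi> m - lam_\<xi> m \<le> tec_bid E m)"

definition dual_optimal ::
  "('n, 't, 'p, 'i, 'j, 'l, 'm) supply_chain \<Rightarrow>
   ('n, 't, 'p, 'i, 'j, 'l, 'm) duals \<Rightarrow> bool" where
  "dual_optimal E y \<longleftrightarrow> is_arg_min (dual_objective E) (dual_feasible E) y"

end

theory Submission
  imports Defs
begin

text \<open>
  Revenue adequacy is the clearing constraints read in money. Multiply the balance of product
  \<open>p\<close> at node \<open>s\<close> by the price \<open>\<pi> s p\<close> and add over all nodes and products. Every player's
  flow occurs exactly at the node-product pairs at which the player trades, so collecting the terms
  of one player yields the flow times that player's price: a supplier or consumer occurs once, a
  transporter enters at its receiving and leaves at its base node, a technology enters with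
  the products it generates and leaves with those it consumes. Total consumer payments thus equal
  total supplier, transport and technology revenues (\<open>clearing_revenue_balance\<close>). Splitting suppliers and consumers by the
  sign of their bids and moving the negative parts across gives the theorem.
\<close>

text \<open>
  Double counting: a player \<open>x\<close> at node \<open>a x\<close> trading the products \<open>C x\<close> meets precisely
  the pairs \<open>(a x, p)\<close> with \<open>p \<in> C x\<close>, so the value of flows aggregated node by node can
  be collected player by player.
\<close>

lemma sum_value_by_player:
  fixes \<pi> :: "'s \<Rightarrow> 'p \<Rightarrow> real" and h :: "'x \<Rightarrow> real"
  assumes fin: "finite S" "finite P" "finite X"
    and a: "\<And>x. x \<in> X \<Longrightarrow> a x \<in> S"
    and C: "\<And>x. x \<in> X \<Longrightarrow> C x \<subseteq> P"
  shows "(\<Sum>s\<in>S. \<Sum>p\<in>P. \<pi> s p * (\<Sum>x\<in>{x\<in>X. a x = s \<and> p \<in> C x}. y x p * h x))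
       = (\<Sum>x\<in>X. (\<Sum>p\<in>C x. y x p * \<pi> (a x) p) * h x)"
proof -
  let ?t = "\<lambda>s p x. if a x = s \<and> p \<in> C x then \<pi> s p * (y x p * h x) else 0"
  have "(\<Sum>s\<in>S. \<Sum>p\<in>P. \<pi> s p * (\<Sum>x\<in>{x\<in>X. a x = s \<and> p \<in> C x}. y x p * h x))
      = (\<Sum>s\<in>S. \<Sum>p\<in>P. \<Sum>x\<in>X. ?t s p x)"
    by (auto simp: sum_distrib_left sum.inter_filter fin intro!: sum.cong)
  also have "\<dots> = (\<Sum>s\<in>S. \<Sum>x\<in>X. \<Sum>p\<in>P. ?t s p x)"
    by (intro sum.cong refl sum.swap)
  also have "\<dots> = (\<Sum>x\<in>X. \<Sum>s\<in>S. \<Sum>p\<in>P. ?t s p x)"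
    by (rule sum.swap)
  also have "\<dots> = (\<Sum>x\<in>X. (\<Sum>p\<in>C x. y x p * \<pi> (a x) p) * h x)"
  proof (rule sum.cong[OF refl])
    fix x assume x: "x \<in> X"
    have "(\<Sum>s\<in>S. \<Sum>p\<in>P. ?t s p x)
        = (\<Sum>s\<in>S. if a x = s then \<Sum>p\<in>P. if p \<in> C x then \<pi> s p * (y x p * h x) else 0 else 0)"
      by (intro sum.cong refl) simp
    also have "\<dots> = (\<Sum>p\<in>P. if p \<in> C x then \<pi> (a x) p * (y x p * h x) else 0)"
      using fin(1) a[OF x] by simp
    also have "\<dots> = (\<Sum>p\<in>P \<inter> C x. \<pi> (a x) p * (y x p * h x))"
      by (rule sum.inter_restrict[OF fin(2), symmetric])
    also have "P \<inter> C x = C x"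
      using C[OF x] by blast
    finally show "(\<Sum>s\<in>S. \<Sum>p\<in>P. ?t s p x) = (\<Sum>p\<in>C x. y x p * \<pi> (a x) p) * h x"
      by (simp add: sum_distrib_left mult_ac)
  qed
  finally show ?thesis .
qed

lemma sum_value_by_player_single:
  fixes \<pi> :: "'s \<Rightarrow> 'p \<Rightarrow> real" and h :: "'x \<Rightarrow> real"
  assumes "finite S" "finite P" "finite X"
    and "\<And>x. x \<in> X \<Longrightarrow> a x \<in> S"
    and "\<And>x. x \<in> X \<Longrightarrow> b x \<in> P"
  shows "(\<Sum>s\<in>S. \<Sum>p\<in>P. \<pi> s p * (\<Sum>x\<in>{x\<in>X. a x = s \<and> b x = p}. h x))
       = (\<Sum>x\<in>X. \<pi> (a x) (b x) * h x)"
  using sum_value_by_player[of S P X a "\<lambda>x. {b x}" \<pi> "\<lambda>_ _. 1" h] assms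
  by (simp add: eq_commute)

text \<open>
  The two sides of a clearing constraint are the same quantity, hence worth the same at any
  price; summed over the network, the value of what enters the nodes equals the value of what
  leaves them, and the in- and outgoing values of a transporter or technology combine to its
  price difference.
\<close>

lemma clearing_revenue_balance:
  assumes E: "sc_st E" and feas: "primal_feasible E (g, d, f, \<xi>)"
  shows "(\<Sum>j\<in>consumers E. con_price E \<pi> j * d j)
       = (\<Sum>i\<in>suppliers E. sup_price E \<pi> i * g i)
         + (\<Sum>l\<in>transporters E. tra_price E \<pi> l * f l)
         + (\<Sum>m\<in>technologies E. tec_price E \<pi> m * \<xi> m)"
proof -
  let ?V = "\<lambda>q. \<Sum>s\<in>st_nodes E. \<Sum>p\<in>products E. \<pi> s p * (q s p :: real)"
  have fin: "finite (st_nodes E)" "finite (products E)" "finite (suppliers E)"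
    "finite (consumers E)" "finite (transporters E)" "finite (technologies E)"
    using E by (auto simp: sc_st_def st_nodes_def)
  have sup: "?V (\<lambda>s p. \<Sum>i\<in>sup_at E s p. g i) = (\<Sum>i\<in>suppliers E. sup_price E \<pi> i * g i)"
    unfolding sup_at_def sup_price_def using E fin
    by (intro sum_value_by_player_single) (auto simp: sc_st_def)
  have con: "?V (\<lambda>s p. \<Sum>j\<in>con_at E s p. d j) = (\<Sum>j\<in>consumers E. con_price E \<pi> j * d j)"
    unfolding con_at_def con_price_def using E fin
    by (intro sum_value_by_player_single) (auto simp: sc_st_def)
  have tra_in: "?V (\<lambda>s p. \<Sum>l\<in>tra_in E s p. f l)
      = (\<Sum>l\<in>transporters E. \<pi> (tra_recv E l) (tra_prod E l) * f l)"
    unfolding tra_in_def using E fin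
    by (intro sum_value_by_player_single) (auto simp: sc_st_def)
  have tra_out: "?V (\<lambda>s p. \<Sum>l\<in>tra_out E s p. f l)
      = (\<Sum>l\<in>transporters E. \<pi> (tra_base E l) (tra_prod E l) * f l)"
    unfolding tra_out_def using E fin
    by (intro sum_value_by_player_single) (auto simp: sc_st_def)
  have tec_gen: "?V (\<lambda>s p. \<Sum>m\<in>tec_gen_at E s p. tec_yield E m p * \<xi> m)
      = (\<Sum>m\<in>technologies E. (\<Sum>p\<in>tec_gen E m. tec_yield E m p * \<pi> (tec_node E m) p) * \<xi> m)"
    unfolding tec_gen_at_def using E fin
    by (intro sum_value_by_player) (auto simp: sc_st_def)
  have tec_con: "?V (\<lambda>s p. \<Sum>m\<in>tec_con_at E s p. tec_yield E m p * \<xi> m)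
      = (\<Sum>m\<in>technologies E. (\<Sum>p\<in>tec_con E m. tec_yield E m p * \<pi> (tec_node E m) p) * \<xi> m)"
    unfolding tec_con_at_def using E fin
    by (intro sum_value_by_player) (auto simp: sc_st_def)
  have "?V (\<lambda>s p. (\<Sum>i\<in>sup_at E s p. g i) + (\<Sum>l\<in>tra_in E s p. f l)
          + (\<Sum>m\<in>tec_gen_at E s p. tec_yield E m p * \<xi> m))
      = ?V (\<lambda>s p. (\<Sum>j\<in>con_at E s p. d j) + (\<Sum>l\<in>tra_out E s p. f l)
          + (\<Sum>m\<in>tec_con_at E s p. tec_yield E m p * \<xi> m))"
    using feas by (intro sum.cong refl) simp
  then show ?thesis
    unfolding distrib_left sum.distrib sup con tra_in tra_out tec_gen tec_con
    by (simp add: tra_price_def tec_price_def left_diff_distrib sum_subtractf)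
qed

lemma sum_suppliers_by_sign:
  assumes "finite (suppliers E)"
  shows "(\<Sum>i\<in>suppliers E. (h i :: real))
       = (\<Sum>i\<in>suppliers_pos E. h i) + (\<Sum>i\<in>suppliers_neg E. h i)"
  unfolding suppliers_pos_def suppliers_neg_def using assms
  by (subst sum.union_disjoint[symmetric]) (auto intro: sum.cong)

lemma sum_consumers_by_sign:
  assumes "finite (consumers E)"
  shows "(\<Sum>j\<in>consumers E. (h j :: real))
       = (\<Sum>j\<in>consumers_pos E. h j) + (\<Sum>j\<in>consumers_neg E. h j)"
  unfolding consumers_pos_def consumers_neg_def using assms
  by (subst sum.union_disjoint[symmetric]) (auto intro: sum.cong)

theorem theorem4:
  fixes E :: "('n, 't::linorder, 'p, 'i, 'j, 'l, 'm) supply_chain"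
    and g :: "'i \<Rightarrow> real" and d :: "'j \<Rightarrow> real" and f :: "'l \<Rightarrow> real" and \<xi> :: "'m \<Rightarrow> real"
    and \<pi> :: "'n \<times> 't \<Rightarrow> 'p \<Rightarrow> real"
    and lam_g :: "'i \<Rightarrow> real" and lam_d :: "'j \<Rightarrow> real" and lam_f :: "'l \<Rightarrow> real" and lam_\<xi> :: "'m \<Rightarrow> real"
  assumes "sc_st E"
    and "primal_optimal E (g, d, f, \<xi>)"
    and "dual_optimal E (\<pi>, lam_g, lam_d, lam_f, lam_\<xi>)"
  shows "(\<Sum>j\<in>consumers_pos E. con_price E \<pi> j * d j)
           - (\<Sum>i\<in>suppliers_neg E. sup_price E \<pi> i * g i)
         = - (\<Sum>j\<in>consumers_neg E. con_price E \<pi> j * d j)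
           + (\<Sum>i\<in>suppliers_pos E. sup_price E \<pi> i * g i)
           + (\<Sum>l\<in>transporters E. tra_price E \<pi> l * f l)
           + (\<Sum>m\<in>technologies E. tec_price E \<pi> m * \<xi> m)"
proof -
  have "finite (suppliers E)" "finite (consumers E)"
    using assms(1) by (simp_all add: sc_st_def)
  moreover have "primal_feasible E (g, d, f, \<xi>)"
    using assms(2) by (simp add: primal_optimal_def is_arg_max_def)
  ultimately show ?thesis
    using clearing_revenue_balance[OF assms(1), of g d f \<xi> \<pi>]
    by (simp add: sum_suppliers_by_sign sum_consumers_by_sign)
qed

end
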